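(* Let $X$ be a $T_1$ topological space. Then every ir-path in $X$ is constant.
   Context: $I_{ir}$ denotes the set $[0,1]$ with the left order topology, whose open sets are exactly $[0,b)$ for $0\le b\le 1$ (including $\emptyset$) and $[0,1]$. An ir-path in a topological space $X$ is a continuous map $\gamma:I_{ir}\to X$. *)

theory Defs
  imports "HOL-Analysis.Analysis"
begin

definition ir_open :: "real set \<Rightarrow> bool" where
  "ir_open U \<longleftrightarrow> (\<exists>b. 0 \<le> b \<and> b \<le> 1 \<and> U = {0..<b}) \<or> U = {0..1}"

definition I_ir :: "real topology" where
  "I_ir = topology ir_open"

lemma ir_open_Int:
  assumes "ir_open S" "ir_open T"
  shows "ir_open (S \<inter> T)"
proof -
  consider "S = {0..1}" | "T = {0..1}"
    | b c where "0 \<le> b" "b \<le> 1" "S = {0..<b}" "0 \<le> c" "c \<le> 1" "T = {0..<c}"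
    using assms unfolding ir_open_def by blast
  then show ?thesis
  proof cases
    case 1
    moreover have "T \<subseteq> {0..1}"
      using assms(2) by (auto simp: ir_open_def)
    ultimately show ?thesis
      using assms(2) by (simp add: Int_absorb1)
  next
    case 2
    moreover have "S \<subseteq> {0..1}"
      using assms(1) by (auto simp: ir_open_def)
    ultimately show ?thesis
      using assms(1) by (simp add: Int_absorb2)
  next
    case 3
    then have "S \<inter> T = {0..<min b c}" "0 \<le> min b c" "min b c \<le> 1"
      by auto
    then show ?thesis
      unfolding ir_open_def by blast
  qed
qed

lemma ir_open_Union:
  assumes "\<forall>S\<in>K. ir_open S"
  shows "ir_open (\<Union>K)"
proof (cases "{0..1} \<in> K")
  case True
  moreover have "\<forall>S\<in>K. S \<subseteq> {0..1}"
    using assms by (auto simp: ir_open_def)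
  ultimately have "\<Union>K = {0..1}"
    by (intro equalityI Union_least Union_upper) auto
  then show ?thesis
    by (simp add: ir_open_def)
next
  case False
  define B where "B = insert 0 {b. 0 \<le> b \<and> b \<le> 1 \<and> {0..<b} \<in> K}"
  have B: "B \<noteq> {}" "bdd_above B" "0 \<in> B" "\<forall>b\<in>B. b \<le> 1"
    unfolding B_def by (auto intro!: bdd_aboveI[of _ 1])
  have "x \<in> \<Union>K \<longleftrightarrow> x \<in> {0..<Sup B}" for x
  proof -
    have "x \<in> \<Union>K \<longleftrightarrow> 0 \<le> x \<and> (\<exists>b\<in>B. x < b)"
    proof
      assume "x \<in> \<Union>K"
      then obtain S where S: "S \<in> K" "x \<in> S"
        by blast
      with assms False obtain b where b: "0 \<le> b" "b \<le> 1" "S = {0..<b}"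
        unfolding ir_open_def by blast
      have "b \<in> B"
        using S(1) b by (simp add: B_def)
      moreover have "0 \<le> x" "x < b"
        using S(2) b(3) by simp_all
      ultimately show "0 \<le> x \<and> (\<exists>b\<in>B. x < b)"
        by blast
    next
      assume "0 \<le> x \<and> (\<exists>b\<in>B. x < b)"
      then obtain b where "0 \<le> x" "x < b" "{0..<b} \<in> K"
        unfolding B_def by auto
      then show "x \<in> \<Union>K"
        by (meson UnionI atLeastLessThan_iff)
    qed
    then show ?thesis
      using less_cSup_iff[OF B(1,2)] by simp
  qed
  then have "\<Union>K = {0..<Sup B}"
    by blast
  moreover have "0 \<le> Sup B" "Sup B \<le> 1"
    using cSup_upper[OF B(3,2)] cSup_least[OF B(1), of 1] B(4) by blast+
  ultimately show ?thesis
    unfolding ir_open_def by blast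
qed

lemma openin_I_ir:
  "openin I_ir U \<longleftrightarrow> (\<exists>b. 0 \<le> b \<and> b \<le> 1 \<and> U = {0..<b}) \<or> U = {0..1}"
proof -
  have "istopology ir_open"
    unfolding istopology_def using ir_open_Int ir_open_Union by blast
  then show ?thesis
    by (simp only: I_ir_def topology_inverse' ir_open_def)
qed

lemma topspace_I_ir [simp]: "topspace I_ir = {0..1}"
proof
  show "topspace I_ir \<subseteq> {0..1}"
    unfolding topspace_def by (auto simp: openin_I_ir)
  show "{0..1} \<subseteq> topspace I_ir"
    by (rule openin_subset) (simp add: openin_I_ir)
qed

definition ir_path :: "'a topology \<Rightarrow> (real \<Rightarrow> 'a) \<Rightarrow> bool" where
  "ir_path X \<gamma> \<longleftrightarrow> continuous_map I_ir X \<gamma>"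

end

(* Every nonempty open set of I_ir contains 0, so the preimage of the complement of the
   closed point \<gamma> 0 is empty. *)
theory Submission
  imports Defs
begin

text \<open>The point 0 lies in every nonempty open set of \<open>I_ir\<close>. As points of a T1
  space are closed, the parameters where \<open>\<gamma>\<close> differs from
  \<open>\<gamma> 0\<close> form an open set; it misses 0, so it is empty.\<close>

lemma zero_in_openin_I_ir:
  assumes "openin I_ir U" "U \<noteq> {}"
  shows "0 \<in> U"
  using assms by (auto simp: openin_I_ir)

theorem theorem4:
  fixes X :: "'a topology"
  assumes "t1_space X"
  shows "\<forall>\<gamma>. ir_path X \<gamma> \<longrightarrow> \<gamma> constant_on topspace I_ir"
proof (intro allI impI)
  fix \<gamma> assume "ir_path X \<gamma>"
  then have cont: "continuous_map I_ir X \<gamma>"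
    by (simp add: ir_path_def)
  then have img: "\<gamma> t \<in> topspace X" if "t \<in> {0..1}" for t
    using that continuous_map_image_subset_topspace by fastforce
  define U where "U = {t \<in> topspace I_ir. \<gamma> t \<in> topspace X - {\<gamma> 0}}"
  have "closedin X {\<gamma> 0}"
    \<comment> \<open>\<open>img\<close> at \<open>t = 0\<close> puts \<open>\<gamma> 0\<close> in
      the space, so T1 applies to it.\<close>
    using assms img by (simp add: closedin_t1_singleton)
  then have "openin I_ir U"
    unfolding U_def using cont by (intro openin_continuous_map_preimage) auto
  moreover have "0 \<notin> U"
    by (simp add: U_def)
  ultimately have "U = {}"
    using zero_in_openin_I_ir by blast
  \<comment> \<open>By \<open>img\<close>, \<open>t\<close> can avoid \<open>U\<close> only if
    \<open>\<gamma> t = \<gamma> 0\<close>.\<close>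
  then have "\<gamma> t = \<gamma> 0" if "t \<in> topspace I_ir" for t
    using that img by (auto simp: U_def)
  then show "\<gamma> constant_on topspace I_ir"
    unfolding constant_on_def by blast
qed

end
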